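(* Let $B_1$ be the unit disk in $\mathbb{R}^2$ and $B_{\frac12}$ the concentric disk of radius $\frac12$. Let $f,g\in L\ln L(B_1)$ and $$\triangle u(x)=g(x)u(x)+f(x),\quad x\in B_1,$$ where $u,f,g$ are smooth in $B_1$. Then $$\|u\|_{C(B_{\frac 12})}\leq C\left(\|u\|_{L^1(B_1)}+\|f\|^*_{L\ln L(B_1)}\right),$$ where the constant $C$ depends only on the function $g$ (in particular, not on $u$ or $f$).
   Context: For a space $X$ of finite measure $|X|$, the Zygmund class $L\ln L(X)$ consists of all functions $f$ with $\int_X |f(x)|\max\{0,\ln|f(x)|\}\,dx<\infty$. The non-increasing rearrangement of $f$ is $f^*(t)=\inf\{s\ge 0: |\{x\in X:|f(x)|>s\}|\le t\}$, and $$\|f\|^*_{L\ln L(X)}=\int_0^\infty f^*(t)\ln\frac{|X|}{t}\,dt$$ (note $f^*(t)=0$ for $t\ge|X|$). $\|\cdot\|_{C(X)}$ denotes the supremum norm on $X$, and $\triangle$ is the Euclidean Laplacian. *)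

theory Defs
  imports "HOL-Analysis.Analysis"
begin

text \<open>The class \<open>C\<^sup>k\<close> on an open set, by recursion on directional derivatives.\<close>

primrec Ck_on :: "nat \<Rightarrow> 'a::euclidean_space set \<Rightarrow> ('a \<Rightarrow> real) \<Rightarrow> bool" where
  "Ck_on 0 S f \<longleftrightarrow> continuous_on S f"
| "Ck_on (Suc k) S f \<longleftrightarrow>
     (\<forall>x\<in>S. f differentiable (at x)) \<and>
     (\<forall>v. Ck_on k S (\<lambda>x. frechet_derivative f (at x) v))"

definition smooth_on :: "'a::euclidean_space set \<Rightarrow> ('a \<Rightarrow> real) \<Rightarrow> bool" where
  "smooth_on S f \<longleftrightarrow> (\<forall>k. Ck_on k S f)"

definition laplacian :: "('a::euclidean_space \<Rightarrow> real) \<Rightarrow> 'a \<Rightarrow> real" where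
  "laplacian u x =
     (\<Sum>b\<in>Basis. frechet_derivative (\<lambda>y. frechet_derivative u (at y) b) (at x) b)"

text \<open>
  Functions are total; everything below only looks at their values on \<open>X\<close>.
  Norms take values in \<^typ>\<open>ennreal\<close>, so that a divergent integral is \<open>\<infinity>\<close>.
\<close>

definition L_ln_L :: "'a::euclidean_space set \<Rightarrow> ('a \<Rightarrow> real) set" where
  "L_ln_L X = {f. f \<in> borel_measurable (lebesgue_on X) \<and>
     (\<integral>\<^sup>+x. ennreal (\<bar>f x\<bar> * max 0 (ln \<bar>f x\<bar>)) \<partial>lebesgue_on X) < \<infinity>}"

text \<open>\<open>Inf {} = \<infinity>\<close> in \<^typ>\<open>ennreal\<close>; for measurable \<open>f\<close> and \<open>X\<close> of finite measure
  this can occur only at \<open>t = 0\<close>, i.e. for unbounded \<open>f\<close>.\<close>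

definition rearrangement :: "'a::euclidean_space set \<Rightarrow> ('a \<Rightarrow> real) \<Rightarrow> real \<Rightarrow> ennreal" where
  "rearrangement X f t =
     Inf {ennreal s | s. 0 \<le> s \<and> emeasure lebesgue {x \<in> X. s < \<bar>f x\<bar>} \<le> ennreal t}"

text \<open>\<^const>\<open>ennreal\<close> truncates the negative values of the logarithm to \<open>0\<close>. They occur only
  for \<open>t > |X|\<close>, where the rearrangement vanishes anyway.\<close>

definition L_ln_L_norm :: "'a::euclidean_space set \<Rightarrow> ('a \<Rightarrow> real) \<Rightarrow> ennreal" where
  "L_ln_L_norm X f =
     (\<integral>\<^sup>+t\<in>{0<..}. rearrangement X f t * ennreal (ln (measure lebesgue X / t)) \<partial>lborel)"

definition L1_norm :: "'a::euclidean_space set \<Rightarrow> ('a \<Rightarrow> real) \<Rightarrow> ennreal" where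
  "L1_norm X u = (\<integral>\<^sup>+x. ennreal \<bar>u x\<bar> \<partial>lebesgue_on X)"

definition C_norm :: "'a::euclidean_space set \<Rightarrow> ('a \<Rightarrow> real) \<Rightarrow> ennreal" where
  "C_norm X u = (SUP x\<in>X. ennreal \<bar>u x\<bar>)"

end

theory Submission
  imports Defs
begin

text \<open>
  On the closed disk of radius \<open>3/4\<close> the smooth function \<open>g\<close> is bounded, say by \<open>M\<close>; as the
  constant may depend on \<open>g\<close> in any way, this is all that \<open>g\<close> contributes. The proof is a
  mean value formula followed by an absorption argument.

  Let \<open>cap y = max 0 (1 - |y|\<^sup>2)\<close>. The \<open>cap\<close>-weighted mean of \<open>u\<close> over the disk of radius \<open>r\<close>
  about \<open>x\<close> has the \<open>r\<close>-derivative \<open>\<integral> cap y * (y \<bullet> \<nabla>u (x + r y)) dy\<close>. Since \<open>-cap y * y\<close> is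
  the gradient of the \<open>C\<^sup>1\<close> function \<open>cap\<^sup>2 / 4\<close>, which has compact support, integration by parts
  turns this into \<open>(r / 4) \<integral> (cap y)\<^sup>2 * \<triangle>u (x + r y) dy\<close> without boundary terms. Integrating in \<open>r\<close>
  gives \<open>weighted_mean_value_formula\<close>, which plays the role of Green's representation, with the
  logarithmic kernel spread over the radii \<open>r\<close>.

  If \<open>|\<triangle>u| \<le> A + |f|\<close> on the disk, then in the plane the contribution of \<open>f\<close> is at most
  \<open>\<integral>\<^sub>0\<^sup>R (1 / (4 r)) \<integral>\<^bsub>B(x,r)\<^esub> |f| dz dr\<close>. The inner integral is at most the integral of the
  rearrangement of \<open>f\<close> over \<open>0 < t < r\<^sup>2 V\<close>, \<open>V\<close> being the area of the unit disk; exchanging the two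
  integrals, \<open>\<integral> dr / (4 r)\<close> over \<open>sqrt (t / V) < r < 1\<close> is bounded by the weight \<open>ln (V / t)\<close> of
  the norm. This is \<open>nn_integral_average_le_L_ln_L_norm\<close>, and \<open>pointwise_estimate\<close> collects the
  result.

  Finally let \<open>N\<close> be the maximum of \<open>(3/4 - |x|)\<^sup>2 |u x|\<close> over the disk of radius \<open>3/4\<close>, attained at
  \<open>p\<close>, and apply the estimate at \<open>p\<close> with a radius \<open>R = \<epsilon> d\<close>, where \<open>d = 3/4 - |p|\<close>. On that disk
  \<open>|u| \<le> 4 N / d\<^sup>2\<close>, so the term with \<open>g u\<close> costs only \<open>O(\<epsilon>\<^sup>2 M) N\<close>, which is absorbed for small \<open>\<epsilon>\<close>
  because \<open>N\<close> is finite. A bound for \<open>N\<close> bounds \<open>u\<close> on the disk of radius \<open>1/2\<close>.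
\<close>

section \<open>Integration by parts against the weight on the unit ball\<close>

lemma has_real_derivative_along_line:
  fixes F :: "'a::real_normed_vector \<Rightarrow> real"
  assumes "(F has_derivative F') (at (y + s *\<^sub>R b))"
  shows "((\<lambda>s. F (y + s *\<^sub>R b)) has_real_derivative F' b) (at s)"
proof -
  have "((\<lambda>s. F (y + s *\<^sub>R b)) has_derivative (\<lambda>h. F' (h *\<^sub>R b))) (at s)"
    by (rule has_derivative_compose[of "\<lambda>s. y + s *\<^sub>R b", OF _ assms])
      (auto intro!: derivative_eq_intros)
  moreover have "(\<lambda>h. F' (h *\<^sub>R b)) = (*) (F' b)"
    using assms by (auto simp: linear_cmul[OF has_derivative_linear] fun_eq_iff mult.commute)
  ultimately show ?thesis
    by (simp add: has_field_derivative_def)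
qed

lemma lborel_translate:
  fixes F :: "'a::euclidean_space \<Rightarrow> real"
  assumes "integrable lborel F"
  shows "integrable lborel (\<lambda>y. F (y + c))" "(\<integral>y. F (y + c) \<partial>lborel) = (\<integral>y. F y \<partial>lborel)"
proof -
  have [measurable]: "F \<in> borel_measurable borel"
    using assms by auto
  have "integrable (distr lborel borel ((+) c)) F"
    using assms by (simp add: lborel_distr_plus)
  then show "integrable lborel (\<lambda>y. F (y + c))"
    by (subst (asm) integrable_distr_eq) (auto simp: add.commute)
  have "(\<integral>y. F y \<partial>(distr lborel borel ((+) c))) = (\<integral>y. F (c + y) \<partial>lborel)"
    by (rule integral_distr) auto
  then show "(\<integral>y. F (y + c) \<partial>lborel) = (\<integral>y. F y \<partial>lborel)"
    by (simp add: lborel_distr_plus add.commute)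
qed

text \<open>The divergence theorem without boundary: the integrals of the difference quotients vanish by
  translation invariance, and the quotients converge boundedly.\<close>

lemma integral_directional_derivative_eq_0:
  fixes F :: "'a::euclidean_space \<Rightarrow> real"
  assumes der: "\<And>y. (F has_derivative F' y) (at y)"
    and cont: "continuous_on UNIV (\<lambda>y. F' y b)"
    and K: "compact K" and supp: "\<And>y. y \<notin> K \<Longrightarrow> F y = 0"
  shows "(\<integral>y. F' y b \<partial>lborel) = 0"
proof -
  obtain e where e: "K \<subseteq> cball 0 e"
    using bounded_subset_ballD[OF compact_imp_bounded[OF K], of 0] ball_subset_cball by (meson order_trans)
  have F'0: "F' y b = 0" if "y \<notin> K" for y
  proof -
    have "(F has_derivative (\<lambda>_. 0)) (at y)"
      by (rule has_derivative_transform_within_open[of "\<lambda>_. 0" _ y UNIV "- K"])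
        (use K that supp in \<open>auto simp: compact_imp_closed open_Compl\<close>)
    from has_derivative_unique[OF this der[of y]] show ?thesis
      by (metis (full_types))
  qed
  obtain B where B: "\<bar>F' y b\<bar> \<le> B" for y
  proof -
    have "bounded ((\<lambda>y. F' y b) ` K)"
      by (intro compact_imp_bounded compact_continuous_image K continuous_on_subset[OF cont]) auto
    then obtain B where "\<forall>y\<in>K. \<bar>F' y b\<bar> \<le> B"
      by (auto simp: bounded_iff)
    then have "\<bar>F' y b\<bar> \<le> max 0 B" for y
      using F'0[of y] by (cases "y \<in> K") (auto intro: order_trans)
    then show ?thesis using that by blast
  qed
  have contF: "continuous_on UNIV F"
    by (rule continuous_at_imp_continuous_on) (use der has_derivative_continuous in blast)
  have [measurable]: "F \<in> borel_measurable borel" "(\<lambda>y. F' y b) \<in> borel_measurable borel"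
    using contF cont by (auto intro: borel_measurable_continuous_onI)
  have intF: "integrable lborel F"
  proof -
    have "integrable lborel (\<lambda>x. indicator K x *\<^sub>R F x)"
      by (intro borel_integrable_compact K continuous_on_subset[OF contF]) auto
    also have "(\<lambda>x. indicator K x *\<^sub>R F x) = F"
      using supp by (auto simp: indicator_def fun_eq_iff)
    finally show ?thesis .
  qed
  define q where "q n y = (F (y + (1 / Suc n) *\<^sub>R b) - F y) / (1 / Suc n)" for n :: nat and y
  have q0: "(\<integral>y. q n y \<partial>lborel) = 0" for n
    unfolding q_def using lborel_translate[OF intF, of "(1 / Suc n) *\<^sub>R b"] intF
    by simp
  have qbound: "\<bar>q n y\<bar> \<le> B" for n y
  proof -
    obtain z :: real where "F (y + (1 / Suc n) *\<^sub>R b) - F (y + 0 *\<^sub>R b) = (1 / Suc n - 0) * F' (y + z *\<^sub>R b) b"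
      using MVT2[of 0 "1 / Suc n" "\<lambda>s. F (y + s *\<^sub>R b)" "\<lambda>s. F' (y + s *\<^sub>R b) b"]
        has_real_derivative_along_line[OF der] by auto
    then have "q n y = F' (y + z *\<^sub>R b) b"
      by (simp add: q_def)
    then show ?thesis using B by simp
  qed
  have qsupp: "q n y = 0" if "y \<notin> cball 0 (e + norm b)" for n y
  proof -
    have "norm ((1 / Suc n) *\<^sub>R b) \<le> norm b"
      by (simp add: divide_simps mult_left_le_one_le mult_le_cancel_left1 add_increasing algebra_simps)
    moreover have "norm y \<le> norm (y + (1 / Suc n) *\<^sub>R b) + norm ((1 / Suc n) *\<^sub>R b)"
      using norm_triangle_ineq4[of "y + (1 / Suc n) *\<^sub>R b" "(1 / Suc n) *\<^sub>R b"] by simp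
    ultimately have "y + (1 / Suc n) *\<^sub>R b \<notin> cball 0 e"
      using that unfolding mem_cball_0 by linarith
    moreover have "y \<notin> cball 0 e"
      using that norm_ge_zero[of b] unfolding mem_cball_0 by linarith
    ultimately have "y + (1 / Suc n) *\<^sub>R b \<notin> K" "y \<notin> K"
      using e by blast+
    then show ?thesis
      using supp by (simp add: q_def)
  qed
  have qlim: "(\<lambda>n. q n y) \<longlonglongrightarrow> F' y b" for y
  proof -
    have "((\<lambda>s. F (y + s *\<^sub>R b)) has_real_derivative F' y b) (at 0)"
      using has_real_derivative_along_line[of F "F' y" y 0 b] der by simp
    then have *: "((\<lambda>h. (F (y + h *\<^sub>R b) - F y) / h) \<longlongrightarrow> F' y b) (at 0)"
      by (simp add: DERIV_def)
    have "filterlim (\<lambda>n. 1 / real (Suc n)) (at 0) sequentially"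
      using LIMSEQ_inverse_real_of_nat by (auto simp: filterlim_at inverse_eq_divide)
    from filterlim_compose[OF * this] show ?thesis
      by (simp add: q_def)
  qed
  have "(\<lambda>n. \<integral>y. q n y \<partial>lborel) \<longlonglongrightarrow> (\<integral>y. F' y b \<partial>lborel)"
  proof (rule integral_dominated_convergence[where w="\<lambda>y. B * indicator (cball 0 (e + norm b)) y"])
    show "AE y in lborel. norm (q n y) \<le> B * indicator (cball 0 (e + norm b)) y" for n
      using qbound qsupp by (auto simp: indicator_def)
    show "q n \<in> borel_measurable lborel" for n
      unfolding q_def by measurable
    show "integrable lborel (\<lambda>y. B * indicator (cball 0 (e + norm b)) (y::'a))"
      by (intro integrable_mult_right integrable_real_indicator) (use emeasure_lborel_cball_finite[of 0 "e + norm b"] in \<open>auto simp: top.not_eq_extremum\<close>)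
  qed (use qlim in auto)
  then show ?thesis
    by (simp add: q0 LIMSEQ_const_iff)
qed

text \<open>The weight is chosen so that it vanishes on the unit sphere and so that its square is still
  \<open>C\<^sup>1\<close> on the whole space.\<close>

definition cap :: "'a::euclidean_space \<Rightarrow> real" where
  "cap y = max 0 (1 - y \<bullet> y)"

lemma cap_nonneg: "0 \<le> cap y" and cap_le_1: "cap y \<le> 1"
  by (auto simp: cap_def)

lemma cap_eq_0: "y \<notin> ball 0 1 \<Longrightarrow> cap y = 0"
  by (auto simp: cap_def dot_square_norm one_le_power)

lemma continuous_on_cap [continuous_intros]: "continuous_on S cap"
  unfolding cap_def by (intro continuous_intros)

lemma has_real_derivative_pos_part_squared:
  "((\<lambda>s::real. (max 0 s)\<^sup>2) has_real_derivative 2 * max 0 s) (at s)"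
proof (cases s "0::real" rule: linorder_cases)
  case less
  have "((\<lambda>s. 0) has_real_derivative 0) (at s)" by simp
  then have "((\<lambda>s::real. (max 0 s)\<^sup>2) has_real_derivative 0) (at s)"
    by (rule has_field_derivative_transform_within_open[of _ _ _ "{..<0}"]) (use less in auto)
  then show ?thesis using less by simp
next
  case equal
  have "((\<lambda>h::real. max 0 h) \<longlongrightarrow> max 0 0) (at 0)"
    by (intro tendsto_intros)
  moreover have "(\<lambda>h::real. (max 0 h)\<^sup>2 / h) = max 0"
    by (auto simp: power2_eq_square max_def)
  ultimately have "((\<lambda>h::real. (max 0 h)\<^sup>2 / h) \<longlongrightarrow> 0) (at 0)"
    by simp
  then show ?thesis
    using equal by (simp add: DERIV_def)
next
  case greater
  have "((\<lambda>s. s\<^sup>2) has_real_derivative 2 * s) (at s)"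
    by (auto intro!: derivative_eq_intros)
  then have "((\<lambda>s::real. (max 0 s)\<^sup>2) has_real_derivative 2 * s) (at s)"
    by (rule has_field_derivative_transform_within_open[of _ _ _ "{0<..}"]) (use greater in auto)
  then show ?thesis using greater by simp
qed

lemma has_derivative_cap_squared:
  "((\<lambda>y. (cap y)\<^sup>2) has_derivative (\<lambda>h. - 4 * cap y * (y \<bullet> h))) (at y)"
proof -
  have "((\<lambda>y::'a. 1 - y \<bullet> y) has_derivative (\<lambda>h. - 2 * (y \<bullet> h))) (at y)"
    by (auto intro!: derivative_eq_intros simp: inner_commute)
  from has_derivative_compose[OF this
      has_real_derivative_pos_part_squared[unfolded has_field_derivative_def]]
  show ?thesis
    by (simp add: cap_def mult_ac)
qed

lemma integrable_cap_mult:
  fixes h :: "'a::euclidean_space \<Rightarrow> real"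
  assumes "continuous_on (cball 0 1) h"
  shows "integrable lborel (\<lambda>y. cap y * h y)"
proof -
  have "integrable lborel (\<lambda>y. indicator (cball 0 1) y *\<^sub>R (cap y * h y))"
    by (intro borel_integrable_compact continuous_intros assms) auto
  also have "(\<lambda>y. indicator (cball 0 1) y *\<^sub>R (cap y * h y)) = (\<lambda>y. cap y * h y)"
    by (auto simp: indicator_def fun_eq_iff cap_eq_0)
  finally show ?thesis .
qed

text \<open>The function \<open>(cap y)\<^sup>2 w y / 4\<close> has compact support and its derivative along \<open>b\<close> is
  \<open>(cap y)\<^sup>2 D\<^sub>b w / 4 - cap y (y \<bullet> b) w y\<close>. Nothing is known about \<open>w\<close> off \<open>U\<close>, but there the
  weight is locally zero.\<close>

lemma integral_cap_times_coordinate: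
  fixes w :: "'a::euclidean_space \<Rightarrow> real"
  assumes U: "open U" "cball 0 1 \<subseteq> U"
    and der: "\<And>y. y \<in> U \<Longrightarrow> (w has_derivative w' y) (at y)"
    and cont: "continuous_on U (\<lambda>y. w' y b)"
  shows "(\<integral>y. cap y * (w y * (y \<bullet> b)) \<partial>lborel) = (\<integral>y. (cap y)\<^sup>2 * w' y b \<partial>lborel) / 4"
proof -
  define F' where "F' y h = (cap y)\<^sup>2 * w' y h + (- 4 * cap y * (y \<bullet> h)) * w y" for y h
  have cap0: "cap y = 0" if "y \<notin> cball 0 1" for y :: 'a
    using that by (intro cap_eq_0) auto
  have contw: "continuous_on U w"
    by (rule continuous_at_imp_continuous_on) (use der has_derivative_continuous in blast)
  have derF: "((\<lambda>y. (cap y)\<^sup>2 * w y) has_derivative F' y) (at y)" for y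
  proof (cases "y \<in> U")
    case True
    show ?thesis
      unfolding F'_def by (rule has_derivative_mult[OF has_derivative_cap_squared der[OF True]])
  next
    case False
    have "((\<lambda>y. (cap y)\<^sup>2 * w y) has_derivative (\<lambda>_. 0)) (at y)"
      by (rule has_derivative_transform_within_open[of "\<lambda>_. 0" _ y UNIV "- cball 0 1"])
        (use False U cap0 in auto)
    moreover have "cap y = 0"
      using False U by (intro cap0) auto
    then have "F' y = (\<lambda>_. 0)"
      by (simp add: F'_def fun_eq_iff)
    ultimately show ?thesis by simp
  qed
  have contF': "continuous_on UNIV (\<lambda>y. F' y b)"
  proof -
    have "continuous_on (U \<union> - cball 0 1) (\<lambda>y. F' y b)"
    proof (rule continuous_on_open_Un)
      show "continuous_on U (\<lambda>y. F' y b)"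
        unfolding F'_def by (intro continuous_intros cont contw)
      have "continuous_on (- cball 0 1) (\<lambda>y::'a. 0::real)"
        by simp
      then show "continuous_on (- cball 0 1) (\<lambda>y. F' y b)"
        by (rule continuous_on_eq) (auto simp: F'_def cap0)
    qed (use U in auto)
    moreover have "U \<union> - cball 0 1 = UNIV" using U by auto
    ultimately show ?thesis by simp
  qed
  have int: "integrable lborel (\<lambda>y. cap y * h y)" if "continuous_on U h" for h :: "'a \<Rightarrow> real"
    using integrable_cap_mult continuous_on_subset[OF that U(2)] by blast
  have "0 = (\<integral>y. F' y b \<partial>lborel)"
    by (rule integral_directional_derivative_eq_0[OF derF contF', of "cball 0 1", symmetric])
      (auto simp: cap0)
  also have "\<dots> = (\<integral>y. cap y * (cap y * w' y b) - 4 * (cap y * (w y * (y \<bullet> b))) \<partial>lborel)"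
    by (rule Bochner_Integration.integral_cong) (auto simp: F'_def power2_eq_square)
  also have "\<dots> = (\<integral>y. cap y * (cap y * w' y b) \<partial>lborel) - 4 * (\<integral>y. cap y * (w y * (y \<bullet> b)) \<partial>lborel)"
    by (subst Bochner_Integration.integral_diff)
      (auto intro!: int integrable_mult_right continuous_intros cont contw)
  finally show ?thesis
    by (simp add: power2_eq_square mult.assoc)
qed


section \<open>A mean value formula with the Laplacian as remainder\<close>

lemma Ck_on_2D:
  assumes "Ck_on 2 S u"
  shows "\<And>x. x \<in> S \<Longrightarrow> (u has_derivative frechet_derivative u (at x)) (at x)"
    and "\<And>x b. x \<in> S \<Longrightarrow> ((\<lambda>y. frechet_derivative u (at y) b) has_derivative
           frechet_derivative (\<lambda>y. frechet_derivative u (at y) b) (at x)) (at x)"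
    and "\<And>b c. continuous_on S (\<lambda>x. frechet_derivative (\<lambda>y. frechet_derivative u (at y) b) (at x) c)"
  using assms by (auto simp: numeral_2_eq_2 frechet_derivative_works[symmetric])

text \<open>Each partial derivative of \<open>u\<close>, rescaled to the unit ball, is integrated by parts against the
  weight; the factor \<open>r\<close> is the inner derivative of the rescaling.\<close>

lemma weighted_integral_radial_derivative:
  fixes u :: "'a::euclidean_space \<Rightarrow> real"
  assumes S: "open S" "cball x r \<subseteq> S" "0 \<le> r" and u: "Ck_on 2 S u"
  shows "(\<integral>y. cap y * frechet_derivative u (at (x + r *\<^sub>R y)) y \<partial>lborel)
    = (r / 4) * (\<integral>y. (cap y)\<^sup>2 * laplacian u (x + r *\<^sub>R y) \<partial>lborel)"
proof -
  define D where "D b z = frechet_derivative u (at z) b" for b z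
  define D2 where "D2 b z = frechet_derivative (D b) (at z)" for b z
  have derD: "(D b has_derivative D2 b z) (at z)" if "z \<in> S" for b z
    unfolding D_def D2_def using Ck_on_2D(2)[OF u that] by simp
  have contD2: "continuous_on S (\<lambda>z. D2 b z b)" for b
    using Ck_on_2D(3)[OF u] by (simp add: D2_def D_def[abs_def])
  have contD: "continuous_on S (D b)" for b
    by (rule continuous_at_imp_continuous_on) (use derD has_derivative_continuous in blast)
  define U where "U = {y. x + r *\<^sub>R y \<in> S}"
  have U: "open U"
    unfolding U_def using S(1)
    by (intro open_vimage[of S "\<lambda>y. x + r *\<^sub>R y", unfolded vimage_def] continuous_intros)
  have U1: "cball 0 1 \<subseteq> U"
  proof
    fix y :: 'a assume "y \<in> cball 0 1"
    then have "x + r *\<^sub>R y \<in> cball x r"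
      using S(3) by (simp add: dist_norm mult_left_le)
    then show "y \<in> U" using S(2) by (auto simp: U_def)
  qed
  have comp: "continuous_on U (\<lambda>y. h (x + r *\<^sub>R y))" if "continuous_on S h" for h :: "'a \<Rightarrow> real"
    by (rule continuous_on_compose2[OF that]) (auto simp: U_def intro!: continuous_intros)
  have coord: "(\<integral>y. cap y * (D b (x + r *\<^sub>R y) * (y \<bullet> b)) \<partial>lborel)
      = (\<integral>y. (cap y)\<^sup>2 * (r * D2 b (x + r *\<^sub>R y) b) \<partial>lborel) / 4" for b
  proof -
    have "(\<integral>y. cap y * (D b (x + r *\<^sub>R y) * (y \<bullet> b)) \<partial>lborel)
      = (\<integral>y. (cap y)\<^sup>2 * D2 b (x + r *\<^sub>R y) (r *\<^sub>R b) \<partial>lborel) / 4"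
    proof (rule integral_cap_times_coordinate[OF U U1, where w' = "\<lambda>y h. D2 b (x + r *\<^sub>R y) (r *\<^sub>R h)"])
      show "((\<lambda>y. D b (x + r *\<^sub>R y)) has_derivative (\<lambda>h. D2 b (x + r *\<^sub>R y) (r *\<^sub>R h))) (at y)"
        if "y \<in> U" for y
        by (rule has_derivative_compose[of "\<lambda>y. x + r *\<^sub>R y" "\<lambda>h. r *\<^sub>R h", OF _ derD])
          (use that in \<open>auto simp: U_def intro!: derivative_eq_intros\<close>)
      have "continuous_on U (\<lambda>y. r * D2 b (x + r *\<^sub>R y) b)"
        by (intro continuous_intros comp contD2)
      then show "continuous_on U (\<lambda>y. D2 b (x + r *\<^sub>R y) (r *\<^sub>R b))"
        by (rule continuous_on_eq)
          (auto simp: U_def linear_cmul[OF has_derivative_linear[OF derD]])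
    qed
    also have "(\<integral>y. (cap y)\<^sup>2 * D2 b (x + r *\<^sub>R y) (r *\<^sub>R b) \<partial>lborel)
        = (\<integral>y. (cap y)\<^sup>2 * (r * D2 b (x + r *\<^sub>R y) b) \<partial>lborel)"
    proof (rule Bochner_Integration.integral_cong[OF refl])
      fix y
      show "(cap y)\<^sup>2 * D2 b (x + r *\<^sub>R y) (r *\<^sub>R b) = (cap y)\<^sup>2 * (r * D2 b (x + r *\<^sub>R y) b)"
      proof (cases "y \<in> ball 0 1")
        case True
        then have "y \<in> U" using U1 by auto
        then have "x + r *\<^sub>R y \<in> S" by (simp add: U_def)
        from linear_cmul[OF has_derivative_linear[OF derD[OF this]]] show ?thesis by simp
      qed (simp add: cap_eq_0)
    qed
    finally show ?thesis .
  qed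
  have "(\<integral>y. cap y * frechet_derivative u (at (x + r *\<^sub>R y)) y \<partial>lborel)
      = (\<integral>y. (\<Sum>b\<in>Basis. cap y * (D b (x + r *\<^sub>R y) * (y \<bullet> b))) \<partial>lborel)"
  proof (rule Bochner_Integration.integral_cong[OF refl])
    fix y
    show "cap y * frechet_derivative u (at (x + r *\<^sub>R y)) y
        = (\<Sum>b\<in>Basis. cap y * (D b (x + r *\<^sub>R y) * (y \<bullet> b)))"
    proof (cases "y \<in> ball 0 1")
      case True
      then have "y \<in> U" using U1 by auto
      then have "x + r *\<^sub>R y \<in> S" by (simp add: U_def)
      from Linear_Algebra.linear_componentwise[OF has_derivative_linear[OF Ck_on_2D(1)[OF u this]], of y 1]
      show ?thesis by (simp add: D_def sum_distrib_left mult_ac)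
    qed (simp add: cap_eq_0)
  qed
  also have "\<dots> = (\<Sum>b\<in>Basis. \<integral>y. cap y * (D b (x + r *\<^sub>R y) * (y \<bullet> b)) \<partial>lborel)"
    by (intro Bochner_Integration.integral_sum integrable_cap_mult continuous_intros
        continuous_on_subset[OF comp[OF contD] U1])
  also have "\<dots> = (\<Sum>b\<in>Basis. \<integral>y. cap y * (cap y * (r * D2 b (x + r *\<^sub>R y) b)) / 4 \<partial>lborel)"
    by (simp add: coord power2_eq_square mult.assoc)
  also have "\<dots> = (\<integral>y. (\<Sum>b\<in>Basis. cap y * (cap y * (r * D2 b (x + r *\<^sub>R y) b)) / 4) \<partial>lborel)"
    by (intro Bochner_Integration.integral_sum[symmetric] integrable_divide integrable_cap_mult continuous_intros
        continuous_on_subset[OF comp[OF contD2] U1])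
  also have "\<dots> = (\<integral>y. (r / 4) * ((cap y)\<^sup>2 * laplacian u (x + r *\<^sub>R y)) \<partial>lborel)"
    by (simp add: laplacian_def D2_def D_def[abs_def] sum_distrib_left power2_eq_square mult_ac)
  finally show ?thesis by simp
qed

text \<open>For fixed \<open>y\<close> the fundamental theorem of calculus along the ray \<open>r \<mapsto> x + r y\<close> compares the values
  of \<open>u\<close> at \<open>x\<close> and \<open>x + R y\<close>. Integrating against the weight and exchanging the integrals leaves
  for each \<open>r\<close> the weighted integral of the radial derivative. Differentiation under the
  integral sign is thus avoided.\<close>

theorem weighted_mean_value_formula:
  fixes u :: "'a::euclidean_space \<Rightarrow> real"
  assumes S: "open S" "cball x R \<subseteq> S" "0 \<le> R" and u: "Ck_on 2 S u"
  shows "(\<integral>y. cap (y::'a) \<partial>lborel) * u x = (\<integral>y. cap y * u (x + R *\<^sub>R y) \<partial>lborel)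
    - (\<integral>r. indicator {0..R} r *\<^sub>R ((r / 4) * (\<integral>y. (cap y)\<^sup>2 * laplacian u (x + r *\<^sub>R y) \<partial>lborel)) \<partial>lborel)"
proof -
  define u' where "u' z = frechet_derivative u (at z)" for z
  have der: "(u has_derivative u' z) (at z)" if "z \<in> S" for z
    using Ck_on_2D(1)[OF u that] by (simp add: u'_def)
  have u'_sum: "u' z y = (\<Sum>b\<in>Basis. (y \<bullet> b) * u' z b)" if "z \<in> S" for z y
    using Linear_Algebra.linear_componentwise[OF has_derivative_linear[OF der[OF that]], of y 1] by simp
  have contu: "continuous_on S u"
    by (rule continuous_at_imp_continuous_on) (use der has_derivative_continuous in blast)
  have contu': "continuous_on S (\<lambda>z. u' z b)" for b
    unfolding u'_def
    by (rule continuous_at_imp_continuous_on) (use Ck_on_2D(2)[OF u] has_derivative_continuous in blast)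
  have inS: "x + r *\<^sub>R y \<in> S" if "r \<in> {0..R}" "y \<in> cball 0 1" for r y
  proof -
    have "r * norm y \<le> R * 1"
      using that by (intro mult_mono) auto
    then have "x + r *\<^sub>R y \<in> cball x R"
      using that by (simp add: dist_norm)
    then show ?thesis using S by auto
  qed
  \<comment> \<open>the integrand of the double integral, cut off so that it lives on a compact set\<close>
  define Q where "Q r y = indicator {0..R} r *\<^sub>R (cap y * u' (x + r *\<^sub>R y) y)" for r y
  have Qint: "integrable (lborel \<Otimes>\<^sub>M lborel) (case_prod Q)"
  proof -
    have *: "continuous_on ({0..R} \<times> cball 0 1) (\<lambda>p. h (x + fst p *\<^sub>R snd p))" if "continuous_on S h" for h :: "'a \<Rightarrow> real"
      by (rule continuous_on_compose2[OF that]) (use inS in \<open>auto intro!: continuous_intros simp del: mem_cball_0\<close>)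
    have capsnd: "continuous_on ({0..R} \<times> cball 0 1) (\<lambda>p. cap (snd p :: 'a))"
      by (rule continuous_on_compose2[OF continuous_on_cap]) (auto intro!: continuous_intros)
    have "continuous_on ({0..R} \<times> cball 0 1)
        (\<lambda>p. cap (snd p) * (\<Sum>b\<in>Basis. (snd p \<bullet> b) * u' (x + fst p *\<^sub>R snd p) b))"
      by (intro continuous_intros *[OF contu'] capsnd)
    then have "continuous_on ({0..R} \<times> cball 0 1) (\<lambda>p. cap (snd p) * u' (x + fst p *\<^sub>R snd p) (snd p))"
      by (rule continuous_on_eq) (use inS u'_sum in \<open>auto simp del: mem_cball_0\<close>)
    then have "integrable lborel (\<lambda>p. indicator ({0..R} \<times> cball 0 1) p *\<^sub>R
        (cap (snd p) * u' (x + fst p *\<^sub>R snd p) (snd p)))"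
      by (intro borel_integrable_compact compact_Times) auto
    also have "(\<lambda>p. indicator ({0..R} \<times> cball 0 1) p *\<^sub>R (cap (snd p) * u' (x + fst p *\<^sub>R snd p) (snd p)))
        = case_prod Q"
      by (auto simp: Q_def indicator_def fun_eq_iff cap_eq_0)
    finally show ?thesis by (simp add: lborel_prod)
  qed
  have FTC: "(\<integral>r. Q r y \<partial>lborel) = cap y * u (x + R *\<^sub>R y) - cap y * u x" for y
  proof (cases "y \<in> cball 0 1")
    case True
    have cont: "continuous_on {0..R} (\<lambda>r. h (x + r *\<^sub>R y))" if "continuous_on S h" for h :: "'a \<Rightarrow> real"
      by (rule continuous_on_compose2[OF that]) (use inS True in \<open>auto intro!: continuous_intros simp del: mem_cball_0\<close>)
    have "(\<integral>r. Q r y \<partial>lborel) = cap y * u (x + R *\<^sub>R y) - cap y * u (x + 0 *\<^sub>R y)"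
      unfolding Q_def
    proof (rule integral_FTC_atLeastAtMost[OF S(3)])
      fix r assume r: "0 \<le> r" "r \<le> R"
      have "((\<lambda>r. u (x + r *\<^sub>R y)) has_real_derivative u' (x + r *\<^sub>R y) y) (at r)"
        by (rule has_real_derivative_along_line[OF der[OF inS]]) (use r True in auto)
      then have "((\<lambda>r. cap y * u (x + r *\<^sub>R y)) has_real_derivative cap y * u' (x + r *\<^sub>R y) y) (at r)"
        by (rule DERIV_cmult)
      then show "((\<lambda>r. cap y * u (x + r *\<^sub>R y)) has_vector_derivative cap y * u' (x + r *\<^sub>R y) y) (at r within {0..R})"
        by (simp add: has_real_derivative_iff_has_vector_derivative has_vector_derivative_at_within)
    next
      have "continuous_on {0..R} (\<lambda>r. cap y * (\<Sum>b\<in>Basis. (y \<bullet> b) * u' (x + r *\<^sub>R y) b))"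
        by (intro continuous_intros cont contu')
      then show "continuous_on {0..R} (\<lambda>r. cap y * u' (x + r *\<^sub>R y) y)"
        by (rule continuous_on_eq) (use inS True u'_sum in \<open>auto simp del: mem_cball_0\<close>)
    qed
    then show ?thesis by simp
  qed (simp add: Q_def cap_eq_0)
  have rad: "(\<integral>y. Q r y \<partial>lborel)
      = indicator {0..R} r *\<^sub>R ((r / 4) * (\<integral>y. (cap y)\<^sup>2 * laplacian u (x + r *\<^sub>R y) \<partial>lborel))" for r
  proof (cases "r \<in> {0..R}")
    case True
    then have "cball x r \<subseteq> S" using S(2) by (auto intro: order_trans subset_cball)
    with weighted_integral_radial_derivative[OF S(1) this _ u] True
    show ?thesis by (simp add: Q_def u'_def)
  qed (simp add: Q_def)
  have "(\<integral>y. cap y * u (x + R *\<^sub>R y) \<partial>lborel) - (\<integral>y. cap (y::'a) * u x \<partial>lborel)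
      = (\<integral>y. cap y * u (x + R *\<^sub>R y) - cap y * u x \<partial>lborel)"
  proof (rule Bochner_Integration.integral_diff[symmetric])
    have "continuous_on (cball 0 1) (\<lambda>y. u (x + R *\<^sub>R y))"
      by (rule continuous_on_compose2[OF contu])
        (use inS S(3) in \<open>auto intro!: continuous_intros simp del: mem_cball_0\<close>)
    then show "integrable lborel (\<lambda>y. cap y * u (x + R *\<^sub>R y))"
      by (rule integrable_cap_mult)
    show "integrable lborel (\<lambda>y. cap (y::'a) * u x)"
      by (rule integrable_cap_mult) simp
  qed
  also have "\<dots> = (\<integral>y. (\<integral>r. Q r y \<partial>lborel) \<partial>lborel)"
    by (simp add: FTC)
  also have "\<dots> = (\<integral>r. (\<integral>y. Q r y \<partial>lborel) \<partial>lborel)"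
    by (rule lborel_pair.Fubini_integral[OF Qint])
  finally show ?thesis
    by (simp add: rad)
qed


text \<open>If \<open>f\<close> is not integrable, its Bochner integral is \<open>0\<close> by convention.\<close>

lemma norm_integral_le_nn_integral:
  fixes f :: "'a \<Rightarrow> real"
  shows "ennreal \<bar>\<integral>x. f x \<partial>M\<bar> \<le> (\<integral>\<^sup>+x. ennreal \<bar>f x\<bar> \<partial>M)"
  by (cases "integrable M f")
    (use integral_norm_bound_ennreal[of M f] in \<open>auto simp: not_integrable_integral_eq\<close>)

lemma weighted_value_bound:
  fixes u :: "'a::euclidean_space \<Rightarrow> real"
  assumes S: "open S" "cball x R \<subseteq> S" "0 \<le> R" and u: "Ck_on 2 S u"
  shows "ennreal ((\<integral>y. cap (y::'a) \<partial>lborel) * \<bar>u x\<bar>)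
    \<le> (\<integral>\<^sup>+y\<in>ball 0 1. ennreal \<bar>u (x + R *\<^sub>R y)\<bar> \<partial>lborel)
      + (\<integral>\<^sup>+r\<in>{0<..R}. ennreal (r / 4)
          * (\<integral>\<^sup>+y\<in>ball 0 1. ennreal \<bar>laplacian u (x + r *\<^sub>R y)\<bar> \<partial>lborel) \<partial>lborel)"
proof -
  define I where "I r = (\<integral>y. (cap y)\<^sup>2 * laplacian u (x + r *\<^sub>R y) \<partial>lborel)" for r
  have weight: "ennreal \<bar>c * h\<bar> \<le> ennreal \<bar>h\<bar> * indicator (ball 0 1) y"
    if "0 \<le> c" "c \<le> 1" "y \<notin> ball 0 1 \<Longrightarrow> c = 0" for c h and y :: 'a
    using that by (cases "y \<in> ball 0 1")
      (auto simp: abs_mult mult_left_le_one_le intro!: ennreal_leI)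
  have c0: "0 \<le> (\<integral>y. cap (y::'a) \<partial>lborel)"
    by (intro integral_nonneg_AE) (simp add: cap_nonneg)
  have I: "ennreal \<bar>I r\<bar> \<le> (\<integral>\<^sup>+y\<in>ball 0 1. ennreal \<bar>laplacian u (x + r *\<^sub>R y)\<bar> \<partial>lborel)" for r
    unfolding I_def
    by (rule order_trans[OF norm_integral_le_nn_integral], intro nn_integral_mono weight)
      (auto simp: cap_nonneg cap_le_1 power_le_one cap_eq_0)
  have "ennreal ((\<integral>y. cap (y::'a) \<partial>lborel) * \<bar>u x\<bar>) = ennreal \<bar>(\<integral>y. cap (y::'a) \<partial>lborel) * u x\<bar>"
    using c0 by (simp add: abs_mult)
  also have "\<dots> \<le> ennreal (\<bar>\<integral>y. cap y * u (x + R *\<^sub>R y) \<partial>lborel\<bar>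
      + \<bar>\<integral>r. indicator {0..R} r *\<^sub>R ((r / 4) * I r) \<partial>lborel\<bar>)"
    unfolding I_def weighted_mean_value_formula[OF S u] by (intro ennreal_leI abs_triangle_ineq4)
  also have "\<dots> = ennreal \<bar>\<integral>y. cap y * u (x + R *\<^sub>R y) \<partial>lborel\<bar>
      + ennreal \<bar>\<integral>r. indicator {0..R} r *\<^sub>R ((r / 4) * I r) \<partial>lborel\<bar>"
    by simp
  also have "\<dots> \<le> (\<integral>\<^sup>+y\<in>ball 0 1. ennreal \<bar>u (x + R *\<^sub>R y)\<bar> \<partial>lborel)
      + (\<integral>\<^sup>+r. ennreal \<bar>indicator {0..R} r *\<^sub>R ((r / 4) * I r)\<bar> \<partial>lborel)"
  proof (intro add_mono norm_integral_le_nn_integral)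
    show "ennreal \<bar>\<integral>y. cap y * u (x + R *\<^sub>R y) \<partial>lborel\<bar>
      \<le> (\<integral>\<^sup>+y\<in>ball 0 1. ennreal \<bar>u (x + R *\<^sub>R y)\<bar> \<partial>lborel)"
      by (rule order_trans[OF norm_integral_le_nn_integral], intro nn_integral_mono weight)
        (auto simp: cap_nonneg cap_le_1 cap_eq_0)
  qed
  also have "(\<integral>\<^sup>+r. ennreal \<bar>indicator {0..R} r *\<^sub>R ((r / 4) * I r)\<bar> \<partial>lborel)
      \<le> (\<integral>\<^sup>+r\<in>{0<..R}. ennreal (r / 4)
          * (\<integral>\<^sup>+y\<in>ball 0 1. ennreal \<bar>laplacian u (x + r *\<^sub>R y)\<bar> \<partial>lborel) \<partial>lborel)"
  proof (intro nn_integral_mono)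
    fix r
    show "ennreal \<bar>indicator {0..R} r *\<^sub>R ((r / 4) * I r)\<bar> \<le> ennreal (r / 4)
          * (\<integral>\<^sup>+y\<in>ball 0 1. ennreal \<bar>laplacian u (x + r *\<^sub>R y)\<bar> \<partial>lborel) * indicator {0<..R} r"
    proof (cases "r \<in> {0<..R}")
      case True
      then have "ennreal \<bar>indicator {0..R} r *\<^sub>R ((r / 4) * I r)\<bar> = ennreal (r / 4) * ennreal \<bar>I r\<bar>"
        by (simp add: abs_mult flip: ennreal_mult')
      with True I[of r] show ?thesis
        by (simp add: mult_left_mono)
    qed (auto simp: indicator_def)
  qed
  finally show ?thesis
    by (simp add: add_left_mono)
qed

lemma nn_integral_unit_ball_scale:
  fixes x :: "'a::euclidean_space"
  assumes [measurable]: "h \<in> borel_measurable borel" and r: "0 < r"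
  shows "(\<integral>\<^sup>+z\<in>ball x r. h z \<partial>lborel)
    = ennreal (r ^ DIM('a)) * (\<integral>\<^sup>+y\<in>ball 0 1. h (x + r *\<^sub>R y) \<partial>lborel)"
proof -
  have ind: "indicator (ball x r) (x + r *\<^sub>R y) = (indicator (ball 0 1) y :: ennreal)" for y
    using r by (auto simp: indicator_def dist_norm)
  have [measurable]: "ball (0::'a) 1 \<in> sets borel" "ball x r \<in> sets borel"
    by simp_all
  have "(\<integral>\<^sup>+z\<in>ball x r. h z \<partial>lborel)
      = (\<integral>\<^sup>+z\<in>ball x r. h z \<partial>density (distr lborel borel (\<lambda>y. x + r *\<^sub>R y)) (\<lambda>_. ennreal (\<bar>r\<bar> ^ DIM('a))))"
    using lborel_affine[of r x] r by simp
  also have "\<dots> = (\<integral>\<^sup>+z. ennreal (r ^ DIM('a)) * (h z * indicator (ball x r) z)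
      \<partial>distr lborel borel (\<lambda>y. x + r *\<^sub>R y))"
    by (subst nn_integral_density, measurable) (use r in simp)
  also have "\<dots> = (\<integral>\<^sup>+y. ennreal (r ^ DIM('a)) * (h (x + r *\<^sub>R y) * indicator (ball 0 1) y) \<partial>lborel)"
    by (subst nn_integral_distr, measurable) (simp add: ind)
  also have "\<dots> = ennreal (r ^ DIM('a)) * (\<integral>\<^sup>+y\<in>ball 0 1. h (x + r *\<^sub>R y) \<partial>lborel)"
    by (intro nn_integral_cmult) measurable
  finally show ?thesis .
qed

section \<open>The rearrangement and the logarithmic weight\<close>

text \<open>The layer-cake form of the decreasing rearrangement of a nonnegative \<open>h\<close>: the length of the set of
  levels whose superlevel set has measure above \<open>t\<close>. In this form it is measurable in \<open>t\<close>, so that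
  Tonelli's theorem applies, and it lies below the rearrangement of \<open>f\<close> when \<open>h\<close> is \<open>|f|\<close>
  extended by zero.\<close>

definition layer_rearrangement :: "('a::euclidean_space \<Rightarrow> real) \<Rightarrow> real \<Rightarrow> ennreal" where
  "layer_rearrangement h t = emeasure lborel {s. 0 < s \<and> ennreal t < emeasure lborel {x. s < h x}}"

lemma superlevel_measurable [measurable]:
  fixes h :: "'a::euclidean_space \<Rightarrow> real"
  assumes [measurable]: "h \<in> borel_measurable borel"
  shows "(\<lambda>s. emeasure lborel {x. s < h x}) \<in> borel_measurable borel"
proof -
  have "(\<lambda>s. \<integral>\<^sup>+x. indicator {x. s < h x} x \<partial>lborel) \<in> borel_measurable borel"
    unfolding indicator_def by measurable
  also have "(\<lambda>s. \<integral>\<^sup>+x. indicator {x. s < h x} x \<partial>lborel) = (\<lambda>s. emeasure lborel {x. s < h x})"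
    by (intro ext nn_integral_indicator) simp
  finally show ?thesis .
qed

lemma layer_rearrangement_conv_nn_integral:
  fixes h :: "'a::euclidean_space \<Rightarrow> real"
  assumes [measurable]: "h \<in> borel_measurable borel"
  shows "layer_rearrangement h t = (\<integral>\<^sup>+s. indicator {s. 0 < s \<and> ennreal t < emeasure lborel {x. s < h x}} s \<partial>lborel)"
  unfolding layer_rearrangement_def by (intro nn_integral_indicator[symmetric]) simp

lemma layer_rearrangement_measurable [measurable]:
  fixes h :: "'a::euclidean_space \<Rightarrow> real"
  assumes [measurable]: "h \<in> borel_measurable borel"
  shows "layer_rearrangement h \<in> borel_measurable borel"
  unfolding layer_rearrangement_conv_nn_integral[OF assms, abs_def] indicator_def by measurable

text \<open>The Hardy-Littlewood inequality for an indicator function. The integral of \<open>h\<close> over \<open>E\<close> is the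
  integral over the levels \<open>s\<close> of the measure of \<open>E \<inter> {s < h}\<close>. That measure is at most the smaller of
  the measures of \<open>E\<close> and of \<open>{s < h}\<close>, hence the length of the set of \<open>t > 0\<close> below both; exchanging
  the integrals over \<open>s\<close> and \<open>t\<close> gives the claim.\<close>

lemma nn_integral_le_layer_rearrangement:
  fixes h :: "'a::euclidean_space \<Rightarrow> real"
  assumes [measurable]: "h \<in> borel_measurable borel" "E \<in> sets borel"
  shows "(\<integral>\<^sup>+x\<in>E. ennreal (h x) \<partial>lborel)
    \<le> (\<integral>\<^sup>+t\<in>{t. 0 < t \<and> ennreal t < emeasure lborel E}. layer_rearrangement h t \<partial>lborel)"
proof -
  let ?m = "\<lambda>s. emeasure lborel {x. s < h x}"
  have "(\<integral>\<^sup>+x\<in>E. ennreal (h x) \<partial>lborel)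
      = (\<integral>\<^sup>+x. \<integral>\<^sup>+s. (if 0 < s \<and> s < h x \<and> x \<in> E then 1 else 0) \<partial>lborel \<partial>lborel)"
  proof (rule nn_integral_cong)
    fix x
    have "(\<integral>\<^sup>+s. (if 0 < s \<and> s < h x \<and> x \<in> E then 1 else 0) \<partial>lborel)
        = (\<integral>\<^sup>+s. indicator {0<..<h x} s * indicator E x \<partial>lborel)"
      by (intro nn_integral_cong) (auto simp: indicator_def)
    also have "\<dots> = ennreal (h x) * indicator E x"
      by (cases "0 \<le> h x") (auto simp: nn_integral_multc ennreal_neg)
    finally show "ennreal (h x) * indicator E x
      = (\<integral>\<^sup>+s. (if 0 < s \<and> s < h x \<and> x \<in> E then 1 else 0) \<partial>lborel)" by simp
  qed
  also have "\<dots> = (\<integral>\<^sup>+s. \<integral>\<^sup>+x. (if 0 < s \<and> s < h x \<and> x \<in> E then 1 else 0) \<partial>lborel \<partial>lborel)"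
    by (rule lborel_pair.Fubini') measurable
  also have "\<dots> \<le> (\<integral>\<^sup>+s. \<integral>\<^sup>+t. (if 0 < s \<and> 0 < t \<and> ennreal t < emeasure lborel E \<and> ennreal t < ?m s then 1 else 0)
      \<partial>lborel \<partial>lborel)"
  proof (rule nn_integral_mono)
    fix s :: real
    show "(\<integral>\<^sup>+x. (if 0 < s \<and> s < h x \<and> x \<in> E then 1 else 0) \<partial>lborel)
      \<le> (\<integral>\<^sup>+t. (if 0 < s \<and> 0 < t \<and> ennreal t < emeasure lborel E \<and> ennreal t < ?m s then 1 else 0) \<partial>lborel)"
    proof (cases "0 < s")
      case True
      define a where "a = min (emeasure lborel E) (?m s)"
      have "(\<integral>\<^sup>+x. (if 0 < s \<and> s < h x \<and> x \<in> E then 1 else 0) \<partial>lborel)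
          = (\<integral>\<^sup>+x. indicator (E \<inter> {x. s < h x}) x \<partial>lborel)"
        using True by (intro nn_integral_cong) (auto simp: indicator_def)
      also have "\<dots> \<le> a"
        unfolding a_def by (auto intro!: emeasure_mono)
      also have "a \<le> emeasure lborel {t. 0 < t \<and> ennreal t < a}"
      proof (cases a)
        case (real r)
        then have "{t. 0 < t \<and> ennreal t < a} = {0<..<r}"
          by (auto simp: ennreal_less_iff)
        then show ?thesis using real by simp
      next
        case top
        then have "{t. 0 < t \<and> ennreal t < a} = {0<..}"
          by auto
        moreover have "ennreal (real n) \<le> emeasure lborel {0::real<..}" for n
          using emeasure_mono[of "{0<..<real n}" "{0<..}" lborel] by (auto simp: subset_eq)
        then have "emeasure lborel {0::real<..} = \<infinity>"
          by (metis ennreal_of_nat_eq_real_of_nat infinity_ennreal_def ennreal_Ex_less_of_nat leD top.not_eq_extremum)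
        ultimately show ?thesis using top by simp
      qed
      also have "\<dots> = (\<integral>\<^sup>+t. indicator {t. 0 < t \<and> ennreal t < a} t \<partial>lborel)"
        by (intro nn_integral_indicator[symmetric]) simp
      also have "\<dots> = (\<integral>\<^sup>+t. (if 0 < s \<and> 0 < t \<and> ennreal t < emeasure lborel E \<and> ennreal t < ?m s then 1 else 0) \<partial>lborel)"
        using True by (intro nn_integral_cong) (auto simp: indicator_def a_def)
      finally show ?thesis .
    qed simp
  qed
  also have "\<dots> = (\<integral>\<^sup>+t. \<integral>\<^sup>+s. (if 0 < s \<and> 0 < t \<and> ennreal t < emeasure lborel E \<and> ennreal t < ?m s then 1 else 0)
      \<partial>lborel \<partial>lborel)"
    by (rule lborel_pair.Fubini') measurable
  also have "\<dots> = (\<integral>\<^sup>+t\<in>{t. 0 < t \<and> ennreal t < emeasure lborel E}. layer_rearrangement h t \<partial>lborel)"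
    unfolding layer_rearrangement_conv_nn_integral[OF assms(1)]
    by (subst nn_integral_multc[symmetric], measurable)
      (auto intro!: nn_integral_cong simp: indicator_def)
  finally show ?thesis .
qed

text \<open>If \<open>s'\<close> competes in the infimum that defines the rearrangement, then monotonicity confines the
  levels counted on the left to \<open>0 < s \<le> s'\<close>.\<close>

lemma layer_rearrangement_le_rearrangement:
  fixes f :: "'a::euclidean_space \<Rightarrow> real"
  assumes h: "\<And>x. x \<in> X \<Longrightarrow> h x = \<bar>f x\<bar>" "\<And>x. x \<notin> X \<Longrightarrow> h x = 0"
    and [measurable]: "h \<in> borel_measurable borel"
  shows "layer_rearrangement h t \<le> rearrangement X f t"
  unfolding rearrangement_def
proof (rule Inf_greatest, safe)
  fix s' :: real
  assume s': "0 \<le> s'" "emeasure lebesgue {x \<in> X. s' < \<bar>f x\<bar>} \<le> ennreal t"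
  have eq: "{x \<in> X. s < \<bar>f x\<bar>} = {x. s < h x}" if "0 \<le> s" for s
  proof (rule Collect_cong)
    show "x \<in> X \<and> s < \<bar>f x\<bar> \<longleftrightarrow> s < h x" for x
      using h[of x] that by (cases "x \<in> X") auto
  qed
  have "{s. 0 < s \<and> ennreal t < emeasure lborel {x. s < h x}} \<subseteq> {0..s'}"
  proof safe
    fix s :: real
    assume s: "0 < s" "ennreal t < emeasure lborel {x. s < h x}"
    show "s \<in> {0..s'}"
    proof (rule ccontr)
      assume "s \<notin> {0..s'}"
      then have "emeasure lborel {x. s < h x} \<le> emeasure lborel {x. s' < h x}"
        using s by (intro emeasure_mono) auto
      also have "\<dots> = emeasure lebesgue {x \<in> X. s' < \<bar>f x\<bar>}"
        using s'(1) by (simp add: eq)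
      also have "\<dots> \<le> ennreal t" by fact
      finally show False using s by simp
    qed
  qed
  then have "layer_rearrangement h t \<le> emeasure lborel {0..s'}"
    unfolding layer_rearrangement_def by (intro emeasure_mono) auto
  then show "layer_rearrangement h t \<le> ennreal s'"
    using s'(1) by simp
qed


lemma emeasure_ball_scale:
  fixes x :: "'a::euclidean_space"
  assumes "0 \<le> r"
  shows "emeasure lborel (ball x r) = ennreal (r ^ DIM('a) * measure lebesgue (ball (0::'a) 1))"
  using content_ball_conv_unit_ball[OF assms, of x] emeasure_lborel_ball_finite[of x r]
  by (simp add: emeasure_eq_ennreal_measure top.not_eq_extremum)

text \<open>The radii run from \<open>sqrt (t / V)\<close> to \<open>1\<close>, so the integral is \<open>ln (V / t) / 8\<close>
  for \<open>t < V\<close> and \<open>0\<close> otherwise.\<close>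

lemma nn_integral_inverse_le_ln:
  fixes t V :: real
  assumes "0 < t" "0 < V"
  shows "(\<integral>\<^sup>+r\<in>{r. 0 < r \<and> r \<le> 1 \<and> t < r\<^sup>2 * V}. ennreal (1 / (4 * r)) \<partial>lborel)
    \<le> ennreal (ln (V / t))"
proof -
  define a where "a = sqrt (t / V)"
  have a: "0 < a" using assms by (simp add: a_def)
  have a_le: "a \<le> r" if "0 < r" "t < r\<^sup>2 * V" for r
    unfolding a_def using that assms by (intro real_le_lsqrt) (auto simp: divide_simps)
  have "(\<integral>\<^sup>+r\<in>{r. 0 < r \<and> r \<le> 1 \<and> t < r\<^sup>2 * V}. ennreal (1 / (4 * r)) \<partial>lborel)
      \<le> (\<integral>\<^sup>+r. ennreal (1 / (4 * r)) * indicator {a..1} r \<partial>lborel)"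
    using a_le by (intro nn_integral_mono) (auto simp: indicator_def)
  also have "\<dots> \<le> ennreal (ln (V / t))"
  proof (cases "a \<le> 1")
    case True
    have "(\<integral>\<^sup>+r. ennreal (1 / (4 * r)) * indicator {a..1} r \<partial>lborel) = ennreal (ln 1 / 4 - ln a / 4)"
      by (rule nn_integral_FTC_Icc[OF _ _ _ True])
        (use a in \<open>auto intro!: derivative_eq_intros simp: has_vector_derivative_within_subset divide_simps
          simp flip: has_real_derivative_iff_has_vector_derivative\<close>)
    also have "ln 1 / 4 - ln a / 4 = ln (V / t) / 8"
      unfolding a_def using assms by (simp add: ln_sqrt ln_div field_simps)
    also have "ennreal (ln (V / t) / 8) \<le> ennreal (ln (V / t))"
    proof (rule ennreal_leI)
      have "t \<le> V"
        using True assms unfolding a_def by (simp add: divide_simps)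
      then show "ln (V / t) / 8 \<le> ln (V / t)"
        using assms by simp
    qed
    finally show ?thesis .
  next
    case False
    then have "(\<lambda>r. ennreal (1 / (4 * r)) * indicator {a..1} r) = (\<lambda>_. 0)"
      by (auto simp: indicator_def)
    then show ?thesis by simp
  qed
  finally show ?thesis .
qed

text \<open>This is where the dimension enters: in the plane, rescaling to the disk of radius \<open>r\<close> turns
  \<open>r / 4\<close> into \<open>1 / (4 r)\<close>, whose primitive is the logarithm.\<close>

lemma nn_integral_average_le_L_ln_L_norm:
  fixes f :: "real ^ 2 \<Rightarrow> real"
  assumes h: "\<And>x. x \<in> ball 0 1 \<Longrightarrow> h x = \<bar>f x\<bar>" "\<And>x. x \<notin> ball 0 1 \<Longrightarrow> h x = 0"
    and [measurable]: "h \<in> borel_measurable borel" and R: "R \<le> 1"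
  shows "(\<integral>\<^sup>+r\<in>{0<..R}. ennreal (r / 4) * (\<integral>\<^sup>+y\<in>ball 0 1. ennreal (h (x + r *\<^sub>R y)) \<partial>lborel) \<partial>lborel)
    \<le> L_ln_L_norm (ball 0 1) f"
proof -
  define V where "V = measure lebesgue (ball (0 :: real ^ 2) 1)"
  have V: "0 < V"
    using content_ball_pos[of 1 "0 :: real ^ 2"] by (simp add: V_def)
  have "(\<integral>\<^sup>+r\<in>{0<..R}. ennreal (r / 4) * (\<integral>\<^sup>+y\<in>ball 0 1. ennreal (h (x + r *\<^sub>R y)) \<partial>lborel) \<partial>lborel)
      \<le> (\<integral>\<^sup>+r. \<integral>\<^sup>+t. (if 0 < r \<and> r \<le> 1 \<and> 0 < t \<and> t < r\<^sup>2 * V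
            then ennreal (1 / (4 * r)) * layer_rearrangement h t else 0) \<partial>lborel \<partial>lborel)"
  proof (rule nn_integral_mono)
    fix r :: real
    show "ennreal (r / 4) * (\<integral>\<^sup>+y\<in>ball 0 1. ennreal (h (x + r *\<^sub>R y)) \<partial>lborel) * indicator {0<..R} r
      \<le> (\<integral>\<^sup>+t. (if 0 < r \<and> r \<le> 1 \<and> 0 < t \<and> t < r\<^sup>2 * V
            then ennreal (1 / (4 * r)) * layer_rearrangement h t else 0) \<partial>lborel)"
    proof (cases "0 < r \<and> r \<le> R")
      case True
      have meas: "emeasure lborel (ball x r) = ennreal (r\<^sup>2 * V)"
        using emeasure_ball_scale[of r x] True by (simp add: V_def)
      have "ennreal (r / 4) * (\<integral>\<^sup>+y\<in>ball 0 1. ennreal (h (x + r *\<^sub>R y)) \<partial>lborel)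
          = ennreal (1 / (4 * r)) * (\<integral>\<^sup>+z\<in>ball x r. ennreal (h z) \<partial>lborel)"
      proof -
        have "ennreal (r / 4) = ennreal (1 / (4 * r)) * ennreal (r ^ DIM(real ^ 2))"
          using True by (simp add: power2_eq_square flip: ennreal_mult')
        then show ?thesis
          using True by (subst nn_integral_unit_ball_scale) (simp_all add: mult.assoc)
      qed
      also have "\<dots> \<le> ennreal (1 / (4 * r))
          * (\<integral>\<^sup>+t\<in>{t. 0 < t \<and> ennreal t < emeasure lborel (ball x r)}. layer_rearrangement h t \<partial>lborel)"
        by (intro mult_left_mono nn_integral_le_layer_rearrangement) auto
      also have "\<dots> = (\<integral>\<^sup>+t. ennreal (1 / (4 * r))
          * (layer_rearrangement h t * indicator {t. 0 < t \<and> ennreal t < emeasure lborel (ball x r)} t) \<partial>lborel)"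
        by (rule nn_integral_cmult[symmetric]) measurable
      also have "\<dots> = (\<integral>\<^sup>+t. (if 0 < r \<and> r \<le> 1 \<and> 0 < t \<and> t < r\<^sup>2 * V
            then ennreal (1 / (4 * r)) * layer_rearrangement h t else 0) \<partial>lborel)"
        using True R by (intro nn_integral_cong) (auto simp: indicator_def meas ennreal_less_iff)
      finally show ?thesis using True by simp
    qed simp
  qed
  also have "\<dots> = (\<integral>\<^sup>+t. \<integral>\<^sup>+r. (if 0 < r \<and> r \<le> 1 \<and> 0 < t \<and> t < r\<^sup>2 * V
            then ennreal (1 / (4 * r)) * layer_rearrangement h t else 0) \<partial>lborel \<partial>lborel)"
    by (rule lborel_pair.Fubini') measurable
  also have "\<dots> \<le> L_ln_L_norm (ball 0 1) f"
    unfolding L_ln_L_norm_def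
  proof (rule nn_integral_mono)
    fix t :: real
    show "(\<integral>\<^sup>+r. (if 0 < r \<and> r \<le> 1 \<and> 0 < t \<and> t < r\<^sup>2 * V
            then ennreal (1 / (4 * r)) * layer_rearrangement h t else 0) \<partial>lborel)
      \<le> rearrangement (ball 0 1) f t * ennreal (ln (measure lebesgue (ball (0::real^2) 1) / t)) * indicator {0<..} t"
    proof (cases "0 < t")
      case True
      have "(\<integral>\<^sup>+r. (if 0 < r \<and> r \<le> 1 \<and> 0 < t \<and> t < r\<^sup>2 * V
            then ennreal (1 / (4 * r)) * layer_rearrangement h t else 0) \<partial>lborel)
          = (\<integral>\<^sup>+r. layer_rearrangement h t
              * (ennreal (1 / (4 * r)) * indicator {r. 0 < r \<and> r \<le> 1 \<and> t < r\<^sup>2 * V} r) \<partial>lborel)"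
        using True by (intro nn_integral_cong) (auto simp: indicator_def mult.commute)
      also have "\<dots> = layer_rearrangement h t
          * (\<integral>\<^sup>+r\<in>{r. 0 < r \<and> r \<le> 1 \<and> t < r\<^sup>2 * V}. ennreal (1 / (4 * r)) \<partial>lborel)"
        by (rule nn_integral_cmult) measurable
      also have "\<dots> \<le> rearrangement (ball 0 1) f t * ennreal (ln (V / t))"
        by (intro mult_mono layer_rearrangement_le_rearrangement[OF h] nn_integral_inverse_le_ln True V) auto
      finally show ?thesis
        using True by (simp add: V_def)
    qed simp
  qed
  finally show ?thesis .
qed

section \<open>The pointwise estimate\<close>

lemma L1_norm_eq_lborel:
  assumes "X \<in> sets borel"
  shows "L1_norm X u = (\<integral>\<^sup>+z\<in>X. ennreal \<bar>u z\<bar> \<partial>lborel)"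
  unfolding L1_norm_def using assms
  by (subst nn_integral_restrict_space) (auto simp: nn_integral_completion)

text \<open>In the mean value formula the mean of \<open>u\<close> is bounded by its \<open>L\<^sup>1\<close> norm, the part of the Laplacian
  bounded by \<open>A\<close> contributes with the factor \<open>R\<^sup>2\<close> that makes it small, and the part bounded by \<open>|f|\<close>
  contributes the Zygmund norm.\<close>

lemma pointwise_estimate:
  fixes u f :: "real ^ 2 \<Rightarrow> real"
  assumes u: "Ck_on 2 (ball 0 1) u" and f: "continuous_on (ball 0 1) f"
    and R: "0 < R" "cball x R \<subseteq> ball 0 1"
    and lap: "\<And>z. z \<in> ball x R \<Longrightarrow> \<bar>laplacian u z\<bar> \<le> A + \<bar>f z\<bar>" and A: "0 \<le> A"
  shows "ennreal ((\<integral>y. cap (y :: real ^ 2) \<partial>lborel) * \<bar>u x\<bar>)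
    \<le> ennreal (1 / R\<^sup>2) * L1_norm (ball 0 1) u
      + ennreal (R\<^sup>2 * A * measure lebesgue (ball (0 :: real ^ 2) 1) / 4) + L_ln_L_norm (ball 0 1) f"
proof -
  define V where "V = measure lebesgue (ball (0 :: real ^ 2) 1)"
  have V: "0 \<le> V" by (simp add: V_def)
  have emV: "emeasure lborel (ball (0 :: real ^ 2) 1) = ennreal V"
    using emeasure_ball_scale[of 1 "0 :: real ^ 2"] by (simp add: V_def)
  have "norm x + R \<le> 1"
    using subset_trans[OF R(2) ball_subset_cball] R(1) by (simp add: cball_subset_cball_iff)
  with norm_ge_zero[of x] have R1: "R \<le> 1"
    by linarith
  have sub: "x + r *\<^sub>R y \<in> ball x R" if "0 < r" "r \<le> R" "y \<in> ball 0 1" for r y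
  proof -
    have "r * norm y < r * 1"
      using that by (intro mult_strict_left_mono) auto
    also have "\<dots> \<le> R" using that by simp
    finally show ?thesis using that by (simp add: dist_norm)
  qed
  have ballsub: "ball x R \<subseteq> ball 0 1"
    using R(2) ball_subset_cball by blast
  have [measurable]: "ball (0 :: real ^ 2) 1 \<in> sets borel"
    by simp
  \<comment> \<open>Outside the disk \<open>u\<close> and \<open>f\<close> are arbitrary; their extensions by zero are Borel measurable.\<close>
  define h where "h z = indicator (ball 0 1) z *\<^sub>R \<bar>f z\<bar>" for z
  define v where "v z = indicator (ball 0 1) z *\<^sub>R \<bar>u z\<bar>" for z
  have h_meas [measurable]: "h \<in> borel_measurable borel"
    unfolding h_def[abs_def] by (intro borel_measurable_continuous_on_indicator continuous_intros f) simp
  have contu: "continuous_on (ball 0 1) u"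
    by (rule continuous_at_imp_continuous_on) (use Ck_on_2D(1)[OF u] has_derivative_continuous in blast)
  have v_meas [measurable]: "v \<in> borel_measurable borel"
    unfolding v_def[abs_def] by (intro borel_measurable_continuous_on_indicator continuous_intros contu) simp
  have first: "(\<integral>\<^sup>+y\<in>ball 0 1. ennreal \<bar>u (x + R *\<^sub>R y)\<bar> \<partial>lborel)
      \<le> ennreal (1 / R\<^sup>2) * L1_norm (ball 0 1) u"
  proof -
    have "(\<integral>\<^sup>+y\<in>ball 0 1. ennreal \<bar>u (x + R *\<^sub>R y)\<bar> \<partial>lborel)
        = (\<integral>\<^sup>+y\<in>ball 0 1. ennreal (v (x + R *\<^sub>R y)) \<partial>lborel)"
    proof (rule nn_integral_cong)
      fix y
      have "x + R *\<^sub>R y \<in> ball 0 1" if "y \<in> ball 0 1"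
        using sub[OF R(1) order_refl that] ballsub by blast
      then show "ennreal \<bar>u (x + R *\<^sub>R y)\<bar> * indicator (ball 0 1) y
          = ennreal (v (x + R *\<^sub>R y)) * indicator (ball 0 1) y"
        by (auto simp: v_def indicator_def)
    qed
    also have "\<dots> = ennreal (1 / R\<^sup>2) * (ennreal (R ^ DIM(real ^ 2))
        * (\<integral>\<^sup>+y\<in>ball 0 1. ennreal (v (x + R *\<^sub>R y)) \<partial>lborel))"
      using R(1) by (simp add: mult.assoc[symmetric] flip: ennreal_mult')
    also have "\<dots> = ennreal (1 / R\<^sup>2) * (\<integral>\<^sup>+z\<in>ball x R. ennreal (v z) \<partial>lborel)"
      using R(1) by (subst nn_integral_unit_ball_scale) auto
    also have "\<dots> \<le> ennreal (1 / R\<^sup>2) * L1_norm (ball 0 1) u"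
      unfolding L1_norm_eq_lborel[OF borel_open[OF open_ball]] using ballsub
      by (intro mult_left_mono nn_integral_mono) (auto simp: v_def indicator_def)
    finally show ?thesis .
  qed
  have "(\<integral>\<^sup>+r\<in>{0<..R}. ennreal (r / 4)
          * (\<integral>\<^sup>+y\<in>ball 0 1. ennreal \<bar>laplacian u (x + r *\<^sub>R y)\<bar> \<partial>lborel) \<partial>lborel)
      \<le> (\<integral>\<^sup>+r. ennreal (R * A * V / 4) * indicator {0<..R} r + ennreal (r / 4)
          * (\<integral>\<^sup>+y\<in>ball 0 1. ennreal (h (x + r *\<^sub>R y)) \<partial>lborel) * indicator {0<..R} r \<partial>lborel)"
  proof (rule nn_integral_mono)
    fix r
    show "ennreal (r / 4) * (\<integral>\<^sup>+y\<in>ball 0 1. ennreal \<bar>laplacian u (x + r *\<^sub>R y)\<bar> \<partial>lborel) * indicator {0<..R} r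
      \<le> ennreal (R * A * V / 4) * indicator {0<..R} r + ennreal (r / 4)
          * (\<integral>\<^sup>+y\<in>ball 0 1. ennreal (h (x + r *\<^sub>R y)) \<partial>lborel) * indicator {0<..R} r"
    proof (cases "0 < r \<and> r \<le> R")
      case True
      have "(\<integral>\<^sup>+y\<in>ball 0 1. ennreal \<bar>laplacian u (x + r *\<^sub>R y)\<bar> \<partial>lborel)
          \<le> (\<integral>\<^sup>+y. ennreal A * indicator (ball 0 1) y + ennreal (h (x + r *\<^sub>R y)) * indicator (ball 0 1) y \<partial>lborel)"
      proof (rule nn_integral_mono)
        fix y :: "real ^ 2"
        show "ennreal \<bar>laplacian u (x + r *\<^sub>R y)\<bar> * indicator (ball 0 1) y
          \<le> ennreal A * indicator (ball 0 1) y + ennreal (h (x + r *\<^sub>R y)) * indicator (ball 0 1) y"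
        proof (cases "y \<in> ball 0 1")
          case y: True
          with True have z: "x + r *\<^sub>R y \<in> ball x R" by (intro sub) auto
          then have "h (x + r *\<^sub>R y) = \<bar>f (x + r *\<^sub>R y)\<bar>"
            using ballsub by (auto simp: h_def)
          then show ?thesis
            using lap[OF z] A y by (simp add: ennreal_leI flip: ennreal_plus)
        qed simp
      qed
      also have "\<dots> = ennreal A * ennreal V + (\<integral>\<^sup>+y\<in>ball 0 1. ennreal (h (x + r *\<^sub>R y)) \<partial>lborel)"
        by (subst nn_integral_add, measurable) (simp add: nn_integral_cmult_indicator emV)
      finally have "ennreal (r / 4) * (\<integral>\<^sup>+y\<in>ball 0 1. ennreal \<bar>laplacian u (x + r *\<^sub>R y)\<bar> \<partial>lborel)
          \<le> ennreal (r / 4) * (ennreal A * ennreal V + (\<integral>\<^sup>+y\<in>ball 0 1. ennreal (h (x + r *\<^sub>R y)) \<partial>lborel))"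
        by (rule mult_left_mono) simp
      also have "\<dots> = ennreal (r / 4 * (A * V)) + ennreal (r / 4) * (\<integral>\<^sup>+y\<in>ball 0 1. ennreal (h (x + r *\<^sub>R y)) \<partial>lborel)"
      proof -
        have "0 \<le> r / 4" using True by simp
        with A have "ennreal (r / 4) * (ennreal A * ennreal V) = ennreal (r / 4 * (A * V))"
          by (simp only: ennreal_mult'[symmetric])
        then show ?thesis by (simp only: distrib_left)
      qed
      also have "ennreal (r / 4 * (A * V)) \<le> ennreal (R * A * V / 4)"
        using True A V mult_right_mono[of r R "A * V"] by (intro ennreal_leI) (simp add: mult.assoc)
      finally show ?thesis
        using True by (simp add: add_right_mono)
    qed simp
  qed
  also have "\<dots> = (\<integral>\<^sup>+r. ennreal (R * A * V / 4) * indicator {0<..R} r \<partial>lborel)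
      + (\<integral>\<^sup>+r\<in>{0<..R}. ennreal (r / 4) * (\<integral>\<^sup>+y\<in>ball 0 1. ennreal (h (x + r *\<^sub>R y)) \<partial>lborel) \<partial>lborel)"
    by (rule nn_integral_add) measurable
  also have "\<dots> \<le> ennreal (R\<^sup>2 * A * V / 4) + L_ln_L_norm (ball 0 1) f"
  proof (rule add_mono)
    show "(\<integral>\<^sup>+r. ennreal (R * A * V / 4) * indicator {0<..R} r \<partial>lborel) \<le> ennreal (R\<^sup>2 * A * V / 4)"
      using R(1) A V by (subst nn_integral_cmult_indicator)
        (auto simp: power2_eq_square mult_ac simp flip: ennreal_mult')
    show "(\<integral>\<^sup>+r\<in>{0<..R}. ennreal (r / 4) * (\<integral>\<^sup>+y\<in>ball 0 1. ennreal (h (x + r *\<^sub>R y)) \<partial>lborel) \<partial>lborel)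
      \<le> L_ln_L_norm (ball 0 1) f"
      by (rule nn_integral_average_le_L_ln_L_norm[OF _ _ h_meas R1]) (auto simp: h_def)
  qed
  finally have second: "(\<integral>\<^sup>+r\<in>{0<..R}. ennreal (r / 4)
          * (\<integral>\<^sup>+y\<in>ball 0 1. ennreal \<bar>laplacian u (x + r *\<^sub>R y)\<bar> \<partial>lborel) \<partial>lborel)
      \<le> ennreal (R\<^sup>2 * A * V / 4) + L_ln_L_norm (ball 0 1) f" .
  have "ennreal ((\<integral>y. cap (y :: real ^ 2) \<partial>lborel) * \<bar>u x\<bar>)
      \<le> ennreal (1 / R\<^sup>2) * L1_norm (ball 0 1) u + (ennreal (R\<^sup>2 * A * V / 4) + L_ln_L_norm (ball 0 1) f)"
    by (rule order_trans[OF weighted_value_bound[OF open_ball R(2) _ u] add_mono[OF first second]])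
      (use R(1) in simp)
  then show ?thesis by (simp add: V_def add.assoc)
qed


section \<open>Absorption of the zero-order term\<close>

lemma integral_cap_pos: "0 < (\<integral>y. cap (y::'a::euclidean_space) \<partial>lborel)"
proof -
  have "integrable lborel (cap :: 'a \<Rightarrow> real)"
    using integrable_cap_mult[of "\<lambda>_::'a. 1"] by simp
  moreover have "integrable lborel (\<lambda>y. (1/2::real) * indicator (ball (0::'a) (1/2)) y)"
    using emeasure_lborel_ball_finite[of "0::'a" "1/2"]
    by (intro integrable_mult_right integrable_real_indicator) (auto simp: top.not_eq_extremum)
  moreover have "(1/2::real) * indicator (ball (0::'a) (1/2)) y \<le> cap y" for y
  proof (cases "y \<in> ball 0 (1/2)")
    case True
    then have "(norm y)\<^sup>2 \<le> (1/2)\<^sup>2"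
      by (intro power_mono) auto
    then show ?thesis
      using True by (simp add: cap_def dot_square_norm power2_eq_square)
  qed (simp add: cap_nonneg)
  ultimately have "(\<integral>y. (1/2::real) * indicator (ball (0::'a) (1/2)) y \<partial>lborel) \<le> (\<integral>y. cap (y::'a) \<partial>lborel)"
    by (intro integral_mono)
  moreover have "0 < (\<integral>y. (1/2::real) * indicator (ball (0::'a) (1/2)) y \<partial>lborel)"
    using content_ball_pos[of "1/2" "0::'a"] by simp
  ultimately show ?thesis by linarith
qed

theorem proposition1p3:
  fixes g :: "real ^ 2 \<Rightarrow> real"
  assumes "smooth_on (ball 0 1) g" and "g \<in> L_ln_L (ball 0 1)"
  shows "\<exists>C::real. C > 0 \<and>
    (\<forall>u f :: real ^ 2 \<Rightarrow> real.
       smooth_on (ball 0 1) u \<longrightarrow> smooth_on (ball 0 1) f \<longrightarrow> f \<in> L_ln_L (ball 0 1) \<longrightarrow>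
       (\<forall>x\<in>ball 0 1. laplacian u x = g x * u x + f x) \<longrightarrow>
       C_norm (ball 0 (1/2)) u \<le> ennreal C * (L1_norm (ball 0 1) u + L_ln_L_norm (ball 0 1) f))"
proof -
  define B where "B = cball (0 :: real ^ 2) (3/4)"
  have B: "compact B" "B \<subseteq> ball 0 1"
    by (auto simp: B_def)
  have cont: "continuous_on (ball 0 1) h" if "smooth_on (ball 0 1) h" for h :: "real ^ 2 \<Rightarrow> real"
    using that[unfolded smooth_on_def, rule_format, of 0] by simp
  obtain M where M: "0 \<le> M" "\<And>x. x \<in> B \<Longrightarrow> \<bar>g x\<bar> \<le> M"
  proof -
    have "bounded (g ` B)"
      by (intro compact_imp_bounded compact_continuous_image B continuous_on_subset[OF cont[OF assms(1)]])
    then obtain M where "0 < M" "\<forall>x\<in>B. \<bar>g x\<bar> \<le> M"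
      by (auto simp: bounded_pos)
    then show ?thesis by (intro that[of M]) auto
  qed
  define c where "c = (\<integral>y. cap (y :: real ^ 2) \<partial>lborel)"
  define V where "V = measure lebesgue (ball (0 :: real ^ 2) 1)"
  have c: "0 < c" and V: "0 < V"
    using integral_cap_pos content_ball_pos[of 1 "0 :: real ^ 2"] by (simp_all add: c_def V_def)
  \<comment> \<open>The term with \<open>g u\<close> will contribute at most \<open>\<epsilon>\<^sup>2 M V N\<close>; this choice makes it at most half of \<open>c N\<close>.\<close>
  define \<epsilon> where "\<epsilon> = min (1/2) (c / (2 * V * (M + 1)))"
  have eps: "0 < \<epsilon>" "\<epsilon> \<le> 1/2"
    using c V M(1) by (auto simp: \<epsilon>_def intro: min.cobounded1 simp del: le_divide_eq_numeral1)
  have epsMV: "\<epsilon> * M * V \<le> c / 2"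
  proof -
    have "\<epsilon> * (M * V) \<le> \<epsilon> * ((M + 1) * V)"
      using eps V by (intro mult_left_mono mult_right_mono) auto
    also have "\<dots> \<le> c / (2 * V * (M + 1)) * ((M + 1) * V)"
      using V M(1) by (intro mult_right_mono) (auto simp: \<epsilon>_def)
    also have "\<dots> = c / 2"
    proof -
      have "V \<noteq> 0" "M + 1 \<noteq> 0" using V M(1) by auto
      then show ?thesis by (simp add: divide_simps)
    qed
    finally show ?thesis by (simp add: mult.assoc)
  qed
  \<comment> \<open>\<open>32 = 2 * 4\<^sup>2\<close>: a factor \<open>2\<close> from the absorption, and \<open>3/4 - |x| \<ge> 1/4\<close> on the small disk\<close>
  define C where "C = 32 * (1 / \<epsilon>\<^sup>2 + 1) / c"
  have C: "0 < C"
    using c eps by (auto simp: C_def intro!: divide_pos_pos add_pos_pos)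
  have bound: "C_norm (ball 0 (1/2)) u \<le> ennreal C * (L1_norm (ball 0 1) u + L_ln_L_norm (ball 0 1) f)"
    if u: "smooth_on (ball 0 1) u" and f: "smooth_on (ball 0 1) f"
      and eq: "\<forall>x\<in>ball 0 1. laplacian u x = g x * u x + f x"
    for u f :: "real ^ 2 \<Rightarrow> real"
  proof (cases "L1_norm (ball 0 1) u + L_ln_L_norm (ball 0 1) f")
    case top
    show ?thesis unfolding top using C by (simp add: ennreal_mult_top)
  next
    case (real \<tau>)
    define T where "T = \<tau> * (1 / \<epsilon>\<^sup>2 + 1)"
    \<comment> \<open>The weight vanishes on the boundary circle, which makes room for a disk about any maximum point.\<close>
    define \<phi> where "\<phi> x = (3/4 - norm x)\<^sup>2 * \<bar>u x\<bar>" for x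
    have "\<exists>x\<in>B. \<forall>y\<in>B. \<phi> y \<le> \<phi> x"
      unfolding \<phi>_def
      by (intro continuous_attains_sup B continuous_intros continuous_on_subset[OF cont[OF u]])
        (auto simp: B_def)
    then obtain p where p: "p \<in> B" "\<And>x. x \<in> B \<Longrightarrow> \<phi> x \<le> \<phi> p" by blast
    define N where "N = \<phi> p"
    have N0: "0 \<le> N" by (simp add: N_def \<phi>_def)
    have "c / 2 * N \<le> T"
    proof (cases "N = 0")
      case True
      then show ?thesis using real eps by (simp add: T_def)
    next
      case False
      define d where "d = 3/4 - norm p"
      have N: "N = d\<^sup>2 * \<bar>u p\<bar>" by (simp add: N_def \<phi>_def d_def)
      have d: "0 < d" "d \<le> 1"
      proof -
        show "0 < d"
          using False p(1) by (auto simp: N d_def B_def order_less_le)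
        show "d \<le> 1"
          using norm_ge_zero[of p] unfolding d_def by linarith
      qed
      define R where "R = \<epsilon> * d"
      have R: "0 < R" "R \<le> d / 2"
        using eps d by (auto simp: R_def)
      have sub: "cball p R \<subseteq> B"
        using R d by (auto simp: B_def d_def cball_subset_cball_iff dist_norm)
      have lap: "\<bar>laplacian u z\<bar> \<le> M * (4 * N / d\<^sup>2) + \<bar>f z\<bar>" if z: "z \<in> ball p R" for z
      proof -
        have zB: "z \<in> B" using sub z by auto
        have "norm z \<le> norm p + R"
          using z norm_triangle_sub[of z p] by (simp add: dist_norm norm_minus_commute)
        then have "(d / 2)\<^sup>2 \<le> (3/4 - norm z)\<^sup>2"
          using R d by (intro power_mono) (auto simp: d_def)
        then have "(d / 2)\<^sup>2 * \<bar>u z\<bar> \<le> \<phi> z"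
          unfolding \<phi>_def by (rule mult_right_mono) simp
        also have "\<dots> \<le> N" using p(2)[OF zB] by (simp add: N_def)
        finally have "\<bar>u z\<bar> \<le> 4 * N / d\<^sup>2"
          using d by (simp add: field_simps power2_eq_square)
        then have "\<bar>g z\<bar> * \<bar>u z\<bar> \<le> M * (4 * N / d\<^sup>2)"
          using M zB by (intro mult_mono) auto
        moreover have "laplacian u z = g z * u z + f z"
          using eq zB B(2) by blast
        ultimately show ?thesis
          using abs_triangle_ineq[of "g z * u z" "f z"] by (simp add: abs_mult)
      qed
      have A: "0 \<le> M * (4 * N / d\<^sup>2)" using M N0 by simp
      have "ennreal (c * \<bar>u p\<bar>)
          \<le> ennreal (1 / R\<^sup>2) * L1_norm (ball 0 1) u
            + ennreal (R\<^sup>2 * (M * (4 * N / d\<^sup>2)) * V / 4) + L_ln_L_norm (ball 0 1) f"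
        unfolding c_def V_def
        by (rule pointwise_estimate[OF _ cont[OF f] R(1) _ lap A])
          (use u sub B(2) in \<open>auto simp: smooth_on_def\<close>)
      also have "\<dots> \<le> ennreal (1 / R\<^sup>2) * ennreal \<tau>
            + ennreal (R\<^sup>2 * (M * (4 * N / d\<^sup>2)) * V / 4) + ennreal \<tau>"
        unfolding real(2)[symmetric] by (intro add_mono mult_left_mono) auto
      also have "\<dots> = ennreal (\<tau> / R\<^sup>2 + R\<^sup>2 * (M * (4 * N / d\<^sup>2)) * V / 4 + \<tau>)"
        using real(1) M N0 V by (simp add: ennreal_plus flip: ennreal_mult')
      finally have "c * \<bar>u p\<bar> \<le> \<tau> / R\<^sup>2 + R\<^sup>2 * (M * (4 * N / d\<^sup>2)) * V / 4 + \<tau>"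
        using real(1) M N0 V by (subst (asm) ennreal_le_iff) auto
      then have "d\<^sup>2 * (c * \<bar>u p\<bar>) \<le> d\<^sup>2 * (\<tau> / R\<^sup>2 + R\<^sup>2 * (M * (4 * N / d\<^sup>2)) * V / 4 + \<tau>)"
        by (rule mult_left_mono) simp
      also have "d\<^sup>2 * (c * \<bar>u p\<bar>) = c * N" by (simp add: N)
      also have "d\<^sup>2 * (\<tau> / R\<^sup>2 + R\<^sup>2 * (M * (4 * N / d\<^sup>2)) * V / 4 + \<tau>)
          = \<tau> / \<epsilon>\<^sup>2 + d\<^sup>2 * \<tau> + d\<^sup>2 * \<epsilon> * (\<epsilon> * M * V) * N"
        using d eps by (simp add: R_def field_simps power2_eq_square)
      also have "\<dots> \<le> \<tau> / \<epsilon>\<^sup>2 + 1 * \<tau> + 1 * (c / 2) * N"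
      proof (intro add_mono mult_right_mono order_refl)
        show d1: "d\<^sup>2 \<le> 1" using d by (simp add: power_le_one)
        show "d\<^sup>2 * \<epsilon> * (\<epsilon> * M * V) \<le> 1 * (c / 2)"
          using eps M(1) V epsMV d1 mult_mono[of "d\<^sup>2" 1 \<epsilon> 1] by (intro mult_mono) auto
      qed (use real N0 in auto)
      finally have "c * N \<le> \<tau> / \<epsilon>\<^sup>2 + 1 * \<tau> + 1 * (c / 2) * N" .
      moreover have "T = \<tau> / \<epsilon>\<^sup>2 + \<tau>"
        by (simp add: T_def distrib_left)
      ultimately show ?thesis
        by linarith
    qed
    then have N_le: "N \<le> 2 * T / c"
      using c by (simp add: field_simps)
    have "\<bar>u x\<bar> \<le> C * \<tau>" if x: "x \<in> ball 0 (1/2)" for x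
    proof -
      have "(1/4)\<^sup>2 \<le> (3/4 - norm x)\<^sup>2"
        using x by (intro power_mono) auto
      then have "(1/4)\<^sup>2 * \<bar>u x\<bar> \<le> \<phi> x"
        unfolding \<phi>_def by (rule mult_right_mono) simp
      also have "\<dots> \<le> N"
        using p(2)[of x] x by (simp add: N_def B_def)
      also note N_le
      finally have "\<bar>u x\<bar> \<le> 16 * (2 * T / c)"
        by (simp add: power2_eq_square)
      also have "\<dots> = C * \<tau>" by (simp add: C_def T_def)
      finally show ?thesis .
    qed
    then have "C_norm (ball 0 (1/2)) u \<le> ennreal (C * \<tau>)"
      unfolding C_norm_def by (intro SUP_least ennreal_leI)
    also have "\<dots> = ennreal C * (L1_norm (ball 0 1) u + L_ln_L_norm (ball 0 1) f)"
      using C real by (simp add: ennreal_mult)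
    finally show ?thesis .
  qed
  show ?thesis
    by (intro exI[of _ C] conjI C allI impI bound)
qed

end
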